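(* Let $d\ge 1$ and let $A\subseteq[0,\infty)$ have at least two elements. Then there is a residual set $R\subseteq\Omega$ such that for every configuration $\omega\in R$ and any two lattice points $x,y\in\mathbb{Z}^d$ there exists a geodesic between $x$ and $y$. Furthermore, if $A$ has no isolated points, then there is a residual set $R'\subseteq\Omega$ such that for every $\omega\in R'$ and any two lattice points $x,y\in\mathbb{Z}^d$ the geodesic between $x$ and $y$ exists and is unique.
   Context: Let $E$ be the set of nearest neighbor edges of the lattice $\mathbb{Z}^d$ (edges join lattice points at $\ell_1$-distance $1$). The space of configurations is $\Omega=\prod_{e\in E}A$, where $A$ carries the subspace topology inherited from $\mathbb{R}$ and $\Omega$ the product topology. A subset of $\Omega$ is residual if its complement is meager, i.e. a countable union of nowhere dense sets. For a configuration $\omega=(\tau(e))_{e\in E}\in\Omega$, $\tau(e)$ is the passage time of the edge $e$; for a finite path $\Gamma$ of consecutive edges, $\tau(\Gamma)=\sum_{e\in\Gamma}\tau(e)$. For lattice points $x,y$, $T(x,y)=\inf_\Gamma\tau(\Gamma)$, the infimum being over all finite paths $\Gamma$ connecting $x$ to $y$. A geodesic between $x$ and $y$ (in the configuration $\omega$) is a finite path $\Gamma$ connecting $x$ to $y$ with $\tau(\Gamma)=T(x,y)$. *)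

theory Defs
  imports "HOL-Analysis.Analysis"
begin

definition nowhere_dense_in :: "'a topology \<Rightarrow> 'a set \<Rightarrow> bool" where
  "nowhere_dense_in X S \<longleftrightarrow> S \<subseteq> topspace X \<and> X interior_of (X closure_of S) = {}"

definition meager_in :: "'a topology \<Rightarrow> 'a set \<Rightarrow> bool" where
  "meager_in X S \<longleftrightarrow>
     (\<exists>\<N>. countable \<N> \<and> (\<forall>N\<in>\<N>. nowhere_dense_in X N) \<and> S = \<Union>\<N>)"

definition residual_in :: "'a topology \<Rightarrow> 'a set \<Rightarrow> bool" where
  "residual_in X R \<longleftrightarrow> R \<subseteq> topspace X \<and> meager_in X (topspace X - R)"

text \<open>The lattice of dimension \<open>d\<close> is \<open>int ^ 'd\<close> with \<open>d = CARD('d) \<ge> 1\<close>;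
  an edge is the unordered pair of its endpoints.\<close>

definition adjacent :: "int ^ 'd \<Rightarrow> int ^ 'd \<Rightarrow> bool" where
  "adjacent x y \<longleftrightarrow> (\<Sum>i\<in>UNIV. \<bar>x $ i - y $ i\<bar>) = 1"

definition lattice_edges :: "(int ^ 'd) set set" where
  "lattice_edges = {{x, y} | x y. adjacent x y}"

text \<open>The underlying set is \<open>lattice_edges \<rightarrow>\<^sub>E A\<close>, so that a configuration is
  determined by its values on the edges.\<close>

definition configurations :: "real set \<Rightarrow> ((int ^ 'd) set \<Rightarrow> real) topology" where
  "configurations A = product_topology (\<lambda>e. top_of_set A) lattice_edges"

text \<open>A path is given by the list of its successive vertices. It may revisit vertices and
  edges (an edge counts with multiplicity in the passage time), and \<open>[x]\<close> is the trivial
  path connecting \<open>x\<close> to itself.\<close>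

definition connecting_path :: "int ^ 'd \<Rightarrow> int ^ 'd \<Rightarrow> (int ^ 'd) list \<Rightarrow> bool" where
  "connecting_path x y \<Gamma> \<longleftrightarrow>
     \<Gamma> \<noteq> [] \<and> hd \<Gamma> = x \<and> last \<Gamma> = y \<and> successively adjacent \<Gamma>"

fun path_edges :: "'a list \<Rightarrow> 'a set list" where
  "path_edges (u # v # vs) = {u, v} # path_edges (v # vs)"
| "path_edges _ = []"

definition path_time :: "((int ^ 'd) set \<Rightarrow> real) \<Rightarrow> (int ^ 'd) list \<Rightarrow> real" where
  "path_time \<tau> \<Gamma> = (\<Sum>e\<leftarrow>path_edges \<Gamma>. \<tau> e)"

definition passage_time :: "((int ^ 'd) set \<Rightarrow> real) \<Rightarrow> int ^ 'd \<Rightarrow> int ^ 'd \<Rightarrow> real" where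
  "passage_time \<tau> x y = (INF \<Gamma>\<in>{\<Gamma>. connecting_path x y \<Gamma>}. path_time \<tau> \<Gamma>)"

definition geodesic ::
  "((int ^ 'd) set \<Rightarrow> real) \<Rightarrow> int ^ 'd \<Rightarrow> int ^ 'd \<Rightarrow> (int ^ 'd) list \<Rightarrow> bool" where
  "geodesic \<tau> x y \<Gamma> \<longleftrightarrow> connecting_path x y \<Gamma> \<and> path_time \<tau> \<Gamma> = passage_time \<tau> x y"

end

theory Submission
  imports Defs "HOL-Library.Multiset"
begin

text \<open>
  Fix \<open>b \<in> A\<close> with \<open>b > 0\<close>. An open condition constrains finitely many edges only, so all edges
  of an arbitrarily thick shell far away from the origin can be given the passage time \<open>b\<close>. Once
  crossing such a shell costs more than some path from \<open>x\<close> to \<open>y\<close>, the infimum \<open>T(x,y)\<close> is taken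
  over the finitely many self-avoiding paths inside the shell, hence attained. This happens on an
  open dense set for each of the countably many pairs \<open>x, y\<close>.

  If \<open>A\<close> has no isolated points, then for two paths whose edge multisets differ at an edge \<open>e\<close>, an
  arbitrarily small change of \<open>\<tau> e\<close> makes their passage times different; so, generically, any two
  paths with different edge multisets have different passage times. Such a configuration has only
  self-avoiding geodesics, since cutting out a loop changes the edge multiset, and any two of
  them between the same points have the same edges. A self-avoiding path is determined by its
  starting point and its edges.
\<close>

section \<open>Residual sets\<close>

text \<open>The complement of a dense open set is closed with empty interior, hence nowhere dense,
  and these countably many complements unite to the complement of the intersection. The factor
  \<open>topspace X\<close> matters for empty \<open>\<U>\<close>, where \<open>\<Inter>\<U>\<close>
  is the universal set.\<close>

lemma residual_in_countable_Inter:
  assumes "countable \<U>"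
    and "\<And>U. U \<in> \<U> \<Longrightarrow> openin X U"
    and "\<And>U. U \<in> \<U> \<Longrightarrow> X closure_of U = topspace X"
  shows "residual_in X (topspace X \<inter> \<Inter>\<U>)"
proof -
  have "nowhere_dense_in X (topspace X - U)" if "U \<in> \<U>" for U
    using assms(2,3)[OF that]
    by (simp add: nowhere_dense_in_def closure_of_complement interior_of_complement interior_of_openin)
  moreover have "topspace X - topspace X \<inter> \<Inter>\<U> = \<Union>((\<lambda>U. topspace X - U) ` \<U>)"
    by auto
  ultimately show ?thesis
    unfolding residual_in_def meager_in_def using assms(1)
    by (intro conjI exI[of _ "(\<lambda>U. topspace X - U) ` \<U>"]) auto
qed

text \<open>A basic box around \<open>f\<close> inside \<open>W\<close> has full sides outside a
  finite index set \<open>F\<close>. All other coordinates can then be reassigned freely without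
  leaving \<open>W\<close>.\<close>

lemma openin_product_topology_finite_support:
  assumes "openin (product_topology X I) W" "f \<in> W"
  obtains F where "finite F" "F \<subseteq> I"
    "\<And>g. g \<in> topspace (product_topology X I) \<Longrightarrow> (\<And>i. i \<in> F \<Longrightarrow> g i = f i) \<Longrightarrow> g \<in> W"
proof -
  obtain U where U: "finite {i \<in> I. U i \<noteq> topspace (X i)}" "f \<in> Pi\<^sub>E I U" "Pi\<^sub>E I U \<subseteq> W"
    using assms by (auto simp: openin_product_topology_alt)
  show thesis
  proof (rule that[OF U(1)])
    fix g assume g: "g \<in> topspace (product_topology X I)"
      and eq: "\<And>i. i \<in> {i \<in> I. U i \<noteq> topspace (X i)} \<Longrightarrow> g i = f i"
    have "g i \<in> U i" if "i \<in> I" for i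
      using that g U(2) eq[of i] by (cases "U i = topspace (X i)") (auto simp: PiE_iff)
    then have "g \<in> Pi\<^sub>E I U" using g by (auto simp: PiE_iff)
    then show "g \<in> W" using U(3) by blast
  qed auto
qed

section \<open>Paths\<close>

lemma path_edges_append:
  "path_edges (us @ v # vs) = path_edges (us @ [v]) @ path_edges (v # vs)"
  by (induction us rule: induct_list012) auto

lemma path_time_append:
  "path_time \<tau> (us @ v # vs) = path_time \<tau> (us @ [v]) + path_time \<tau> (v # vs)"
  by (simp add: path_time_def path_edges_append[of us v vs])

lemma path_time_simps [simp]:
  "path_time \<tau> [] = 0"
  "path_time \<tau> [u] = 0"
  "path_time \<tau> (u # v # vs) = \<tau> {u, v} + path_time \<tau> (v # vs)"
  by (simp_all add: path_time_def)

lemma adjacent_in_lattice_edges: "adjacent u v \<Longrightarrow> {u, v} \<in> lattice_edges"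
  by (auto simp: lattice_edges_def)

lemma path_edges_subset_lattice_edges:
  "successively adjacent \<Gamma> \<Longrightarrow> set (path_edges \<Gamma>) \<subseteq> lattice_edges"
  by (induction \<Gamma> rule: path_edges.induct) (auto simp: adjacent_in_lattice_edges)

lemma path_edges_subset_vertices: "e \<in> set (path_edges \<Gamma>) \<Longrightarrow> e \<subseteq> set \<Gamma>"
  by (induction \<Gamma> rule: path_edges.induct) auto

lemma path_time_nonneg:
  assumes "\<forall>e\<in>lattice_edges. 0 \<le> \<tau> e" "successively adjacent \<Gamma>"
  shows "0 \<le> path_time \<tau> \<Gamma>"
  unfolding path_time_def
  using path_edges_subset_lattice_edges[OF assms(2)] assms(1) by (intro sum_list_nonneg) auto

text \<open>In the time of a single edge the passage time is affine, with slope the number of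
  traversals of that edge.\<close>

lemma path_time_fun_upd:
  "path_time (\<tau>(e := t)) \<Gamma> = path_time \<tau> \<Gamma> + real (count (mset (path_edges \<Gamma>)) e) * (t - \<tau> e)"
  by (induction \<Gamma> rule: path_edges.induct) (auto simp: algebra_simps)

text \<open>Telescoping: the increments of \<open>\<phi>\<close> along the path add up to the
  difference at its ends.\<close>

lemma path_time_ge_potential:
  assumes "\<And>u v. adjacent u v \<Longrightarrow> \<phi> v - \<phi> u \<le> \<tau> {u, v}"
    and "successively adjacent \<Gamma>" "\<Gamma> \<noteq> []"
  shows "\<phi> (last \<Gamma>) - \<phi> (hd \<Gamma>) \<le> path_time \<tau> \<Gamma>"
  using assms(2,3)
proof (induction \<Gamma> rule: path_edges.induct)
  case (1 u v vs)
  then show ?case using assms(1)[of u v] by simp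
qed auto

text \<open>The stretch between two visits to a repeated vertex is cut out. It has at least one
  edge, so the edge multiset shrinks strictly; this strictness later shows that generic geodesics
  are self-avoiding.\<close>

lemma connecting_path_remove_loop:
  assumes "connecting_path x y \<Gamma>" "\<not> distinct \<Gamma>"
  obtains \<Delta> where "connecting_path x y \<Delta>" "length \<Delta> < length \<Gamma>"
    "mset (path_edges \<Delta>) \<subset># mset (path_edges \<Gamma>)"
proof -
  obtain us v ws zs where \<Gamma>: "\<Gamma> = us @ [v] @ ws @ [v] @ zs"
    using not_distinct_decomp[OF assms(2)] by blast
  have "path_edges \<Gamma> = path_edges (us @ [v]) @ path_edges (v # ws @ [v]) @ path_edges (v # zs)"
    unfolding \<Gamma> using path_edges_append[of us v "ws @ [v] @ zs"] path_edges_append[of "v # ws" v zs]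
    by simp
  moreover have "path_edges (us @ v # zs) = path_edges (us @ [v]) @ path_edges (v # zs)"
    by (rule path_edges_append)
  moreover have "path_edges (v # ws @ [v]) \<noteq> []"
    by (cases ws) auto
  ultimately have "mset (path_edges (us @ v # zs)) \<subset># mset (path_edges \<Gamma>)"
    by (simp add: subset_mset.less_le)
  moreover have "connecting_path x y (us @ v # zs)"
    using assms(1) unfolding \<Gamma> connecting_path_def
    by (auto simp: successively_append_iff successively_Cons hd_append split: if_splits)
  moreover have "length (us @ v # zs) < length \<Gamma>" by (simp add: \<Gamma>)
  ultimately show thesis by (rule that[rotated 2])
qed

lemma path_time_mset_mono:
  assumes "\<forall>e\<in>lattice_edges. 0 \<le> \<tau> e" "successively adjacent \<Gamma>"
    and "mset (path_edges \<Delta>) \<subseteq># mset (path_edges \<Gamma>)"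
  shows "path_time \<tau> \<Delta> \<le> path_time \<tau> \<Gamma>"
proof -
  obtain M where M: "mset (path_edges \<Gamma>) = mset (path_edges \<Delta>) + M"
    using assms(3) by (metis subset_mset.le_iff_add)
  have "set_mset M \<subseteq> lattice_edges"
    using path_edges_subset_lattice_edges[OF assms(2)] M by (metis set_mset_mset set_mset_union le_sup_iff)
  then have "0 \<le> (\<Sum>e\<in>#M. \<tau> e)"
    using assms(1) by (induction M) auto
  then show ?thesis
    unfolding path_time_def sum_mset_sum_list[symmetric] mset_map M by simp
qed

text \<open>Loops are cut out one at a time, by induction on the length. Minimisation over all paths
  thus reduces to self-avoiding ones, of which a finite region has only finitely many.\<close>

lemma self_avoiding_subpath:
  assumes "\<forall>e\<in>lattice_edges. 0 \<le> \<tau> e" "connecting_path x y \<Gamma>"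
  shows "\<exists>\<Delta>. connecting_path x y \<Delta> \<and> distinct \<Delta> \<and> path_time \<tau> \<Delta> \<le> path_time \<tau> \<Gamma>"
  using assms(2)
proof (induction \<Gamma> rule: length_induct)
  case (1 \<Gamma>)
  show ?case
  proof (cases "distinct \<Gamma>")
    case False
    from connecting_path_remove_loop[OF "1.prems" this]
    obtain \<Delta> where \<Delta>: "connecting_path x y \<Delta>" "length \<Delta> < length \<Gamma>"
      "mset (path_edges \<Delta>) \<subset># mset (path_edges \<Gamma>)" .
    have "path_time \<tau> \<Delta> \<le> path_time \<tau> \<Gamma>"
      using \<Delta>(3) "1.prems"
      by (intro path_time_mset_mono[OF assms(1)]) (auto simp: connecting_path_def subset_mset.less_imp_le)
    with "1.IH" \<Delta>(1,2) show ?thesis by (meson order_trans)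
  qed (use "1.prems" in auto)
qed

text \<open>The starting vertex of a nontrivial self-avoiding path lies on only one of its edges.
  This edge gives the next vertex; deleting it leaves the edge set of the tail, and the induction
  continues there.\<close>

lemma self_avoiding_path_eqI:
  assumes "distinct p" "distinct q" "p \<noteq> []" "q \<noteq> []" "hd p = hd q"
    and "set (path_edges p) = set (path_edges q)"
  shows "p = q"
  using assms
proof (induction p arbitrary: q rule: path_edges.induct)
  case (1 u v vs)
  then obtain q' where q: "q = u # q'" by (cases q) auto
  with 1 obtain w ws where q': "q' = w # ws" by (cases q') auto
  have *: "u \<notin> e" if "e \<in> set (path_edges (v # vs)) \<union> set (path_edges (w # ws))" for e
    using that path_edges_subset_vertices[of e] "1.prems"(1,2) unfolding q q' by fastforce
  have eq: "insert {u, v} (set (path_edges (v # vs))) = insert {u, w} (set (path_edges (w # ws)))"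
    using "1.prems"(6) by (simp add: q q')
  have new: "{u, z} \<notin> set (path_edges (v # vs)) \<union> set (path_edges (w # ws))" for z
    using *[of "{u, z}"] by auto
  have "{u, v} = {u, w}" using eq new[of v] by (metis UnCI insertE insertI1)
  then have "v = w" by (auto simp: doubleton_eq_iff)
  moreover have "set (path_edges (v # vs)) = set (path_edges (w # ws))"
    using eq new[of v] unfolding \<open>v = w\<close> by (metis UnI1 UnI2 insert_ident)
  ultimately have "v # vs = w # ws"
    using "1.prems"(1,2) by (intro "1.IH") (auto simp: q q')
  then show ?case by (simp add: q q')
next
  case ("2_2" u)
  then obtain q' where q: "q = u # q'" by (cases q) auto
  with "2_2" show ?case by (cases q') auto
qed auto

section \<open>The lattice\<close>

definition l1_norm :: "int ^ 'd \<Rightarrow> int" where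
  "l1_norm x = (\<Sum>i\<in>UNIV. \<bar>x $ i\<bar>)"

lemma l1_norm_nonneg: "0 \<le> l1_norm x"
  by (simp add: l1_norm_def sum_nonneg)

lemma l1_norm_diff_le: "adjacent u v \<Longrightarrow> \<bar>l1_norm v - l1_norm u\<bar> \<le> 1"
proof -
  assume "adjacent u v"
  have "\<bar>l1_norm v - l1_norm u\<bar> \<le> (\<Sum>i\<in>UNIV. \<bar>\<bar>v $ i\<bar> - \<bar>u $ i\<bar>\<bar>)"
    unfolding l1_norm_def sum_subtractf[symmetric] by (rule sum_abs)
  also have "\<dots> \<le> (\<Sum>i\<in>UNIV. \<bar>u $ i - v $ i\<bar>)"
    by (rule sum_mono) linarith
  finally show ?thesis using \<open>adjacent u v\<close> by (simp add: adjacent_def)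
qed

lemma finite_l1_ball: "finite {x :: int ^ 'd. l1_norm x \<le> n}"
proof (rule finite_subset)
  show "{x :: int ^ 'd. l1_norm x \<le> n} \<subseteq> vec_lambda ` (UNIV \<rightarrow>\<^sub>E {-n..n})"
  proof
    fix x :: "int ^ 'd" assume x: "x \<in> {x. l1_norm x \<le> n}"
    have "\<bar>x $ i\<bar> \<le> n" for i
      using member_le_sum[of i UNIV "\<lambda>i. \<bar>x $ i\<bar>"] x by (simp add: l1_norm_def)
    then have "vec_nth x \<in> UNIV \<rightarrow>\<^sub>E {-n..n}"
      by (auto simp: abs_le_iff minus_le_iff)
    then show "x \<in> vec_lambda ` (UNIV \<rightarrow>\<^sub>E {-n..n})"
      by (metis image_eqI vec_nth_inverse)
  qed
qed (intro finite_imageI finite_PiE; simp)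

lemma connecting_path_exists: "\<exists>\<Gamma>. connecting_path x y \<Gamma>"
proof (induction "nat (l1_norm (x - y))" arbitrary: x rule: less_induct)
  case less
  show ?case
  proof (cases "x = y")
    case True
    then show ?thesis by (intro exI[of _ "[x]"]) (simp add: connecting_path_def)
  next
    case False
    then obtain i where i: "x $ i \<noteq> y $ i" by (auto simp: vec_eq_iff)
    \<comment> \<open>The neighbour \<open>z\<close> of \<open>x\<close> is one unit closer to
      \<open>y\<close> in a coordinate where the two differ.\<close>
    define s where "s = sgn (y $ i - x $ i)"
    define z where "z = (\<chi> j. if j = i then x $ i + s else x $ j)"
    have z: "z $ i = x $ i + s" "\<And>j. j \<noteq> i \<Longrightarrow> z $ j = x $ j" by (simp_all add: z_def)
    have "(\<Sum>j\<in>UNIV. \<bar>x $ j - z $ j\<bar>) = \<bar>x $ i - z $ i\<bar> + (\<Sum>j\<in>UNIV - {i}. \<bar>x $ j - z $ j\<bar>)"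
      by (rule sum.remove) auto
    moreover have "(\<Sum>j\<in>UNIV - {i}. \<bar>x $ j - z $ j\<bar>) = 0"
      by (rule sum.neutral) (simp add: z)
    moreover have "\<bar>s\<bar> = 1" using i by (simp add: s_def abs_sgn_eq)
    ultimately have adj: "adjacent x z"
      by (simp add: adjacent_def z)
    have "l1_norm (z - y) < l1_norm (x - y)"
      unfolding l1_norm_def
    proof (rule sum_strict_mono_ex1)
      show "\<forall>j\<in>UNIV. \<bar>(z - y) $ j\<bar> \<le> \<bar>(x - y) $ j\<bar>"
        using i z by (auto simp: s_def sgn_if z_def)
      show "\<exists>j\<in>UNIV. \<bar>(z - y) $ j\<bar> < \<bar>(x - y) $ j\<bar>"
        using i z by (intro bexI[of _ i]) (auto simp: s_def sgn_if)
    qed simp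
    then obtain \<Gamma> where "connecting_path z y \<Gamma>"
      using less[of z] l1_norm_nonneg[of "z - y"] by auto
    with adj have "connecting_path x y (x # \<Gamma>)"
      by (auto simp: connecting_path_def successively_Cons)
    then show ?thesis ..
  qed
qed

section \<open>Existence of geodesics\<close>

lemma geodesicI:
  assumes "connecting_path x y \<Gamma>"
    and "\<And>\<Delta>. connecting_path x y \<Delta> \<Longrightarrow> path_time \<tau> \<Gamma> \<le> path_time \<tau> \<Delta>"
  shows "geodesic \<tau> x y \<Gamma>"
  unfolding geodesic_def passage_time_def
  using assms by (auto intro!: cInf_eq_minimum[symmetric])

text \<open>On the reals \<open>INF\<close> is guaranteed to be a lower bound only if the set is
  bounded below; nonnegative edge times supply the bound 0.\<close>

lemma geodesicD:
  assumes "\<forall>e\<in>lattice_edges. 0 \<le> \<tau> e" "geodesic \<tau> x y \<Gamma>" "connecting_path x y \<Delta>"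
  shows "path_time \<tau> \<Gamma> \<le> path_time \<tau> \<Delta>"
proof -
  have "bdd_below (path_time \<tau> ` {\<Gamma>. connecting_path x y \<Gamma>})"
    using path_time_nonneg[OF assms(1)]
    by (intro bdd_belowI[of _ 0]) (auto simp: connecting_path_def)
  then have "passage_time \<tau> x y \<le> path_time \<tau> \<Delta>"
    unfolding passage_time_def using assms(3) by (intro cINF_lower) auto
  then show ?thesis using assms(2) by (simp add: geodesic_def)
qed

section \<open>The cost of crossing a shell\<close>

definition shell_edges :: "int \<Rightarrow> int \<Rightarrow> (int ^ 'd) set set" where
  "shell_edges m n = {{u, v} | u v. adjacent u v \<and> l1_norm u \<in> {m..n} \<and> l1_norm v \<in> {m..n}}"

lemma shell_edges_subset: "shell_edges m n \<subseteq> lattice_edges"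
  by (auto simp: shell_edges_def lattice_edges_def)

lemma finite_shell_edges: "finite (shell_edges m n :: (int ^ 'd) set set)"
proof (rule finite_subset)
  show "shell_edges m n \<subseteq> Pow {x :: int ^ 'd. l1_norm x \<le> n}"
    by (auto simp: shell_edges_def)
qed (simp add: finite_l1_ball)

text \<open>The potential is \<open>c\<close> times the norm truncated to the interval from
  \<open>m\<close> to \<open>n\<close>. It rises by at most \<open>c\<close> along shell edges and
  is constant along all others, so the stretch from the start to \<open>v\<close> costs at least
  \<open>c\<close> times the thickness.\<close>

lemma path_time_leaving_ball:
  assumes nonneg: "\<forall>e\<in>lattice_edges. 0 \<le> \<tau> e"
    and shell: "\<forall>e\<in>shell_edges m n. c \<le> \<tau> e"
    and "0 \<le> c" "m \<le> n" "l1_norm (hd \<Gamma>) \<le> m"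
    and \<Gamma>: "successively adjacent \<Gamma>" "v \<in> set \<Gamma>" "n < l1_norm v"
  shows "c * of_int (n - m) \<le> path_time \<tau> \<Gamma>"
proof -
  obtain us vs where uv: "\<Gamma> = us @ v # vs"
    using \<Gamma>(2) by (meson split_list)
  define \<phi> where "\<phi> u = c * of_int (min n (max m (l1_norm u)))" for u :: "int ^ 'a"
  have potential: "\<phi> w - \<phi> u \<le> \<tau> {u, w}" if adj: "adjacent u w" for u w
  proof (cases "{u, w} \<in> shell_edges m n")
    case True
    have "min n (max m (l1_norm w)) - min n (max m (l1_norm u)) \<le> 1"
      using l1_norm_diff_le[OF adj] by linarith
    then have "real_of_int (min n (max m (l1_norm w)) - min n (max m (l1_norm u))) \<le> 1"
      by (simp only: of_int_le_1_iff)
    then have "\<phi> w - \<phi> u \<le> c * 1"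
      unfolding \<phi>_def right_diff_distrib[symmetric] of_int_diff[symmetric]
      using \<open>0 \<le> c\<close> by (rule mult_left_mono)
    then show ?thesis using bspec[OF shell True] by linarith
  next
    case False
    then have "\<not> (l1_norm u \<in> {m..n} \<and> l1_norm w \<in> {m..n})"
      using adj unfolding shell_edges_def by blast
    \<comment> \<open>One end has norm below \<open>m\<close> or above \<open>n\<close>. As the
      norms are integers differing by at most 1, both ends have norm at most \<open>m\<close> or
      both at least \<open>n\<close>.\<close>
    then have "min n (max m (l1_norm w)) = min n (max m (l1_norm u))"
      using l1_norm_diff_le[OF adj] \<open>m \<le> n\<close> unfolding atLeastAtMost_iff by linarith
    then show ?thesis
      using nonneg adjacent_in_lattice_edges[OF adj] by (simp add: \<phi>_def)
  qed
  have "successively adjacent (us @ [v])" "successively adjacent (v # vs)"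
    using \<Gamma>(1) by (auto simp: uv successively_append_iff)
  then have "\<phi> (last (us @ [v])) - \<phi> (hd (us @ [v])) \<le> path_time \<tau> (us @ [v])"
    and "0 \<le> path_time \<tau> (v # vs)"
    using path_time_ge_potential[of \<phi> \<tau> "us @ [v]", OF potential] path_time_nonneg[OF nonneg]
    by auto
  moreover have "hd (us @ [v]) = hd \<Gamma>" by (simp add: uv hd_append)
  moreover have "\<phi> v = c * of_int n" "\<phi> (hd \<Gamma>) = c * of_int m"
    using assms(4,5) \<Gamma>(3) by (auto simp: \<phi>_def)
  ultimately show ?thesis
    by (simp add: uv path_time_append[of \<tau> us v vs] right_diff_distrib)
qed

text \<open>The minimum over the finite set \<open>S\<close> of self-avoiding paths in the ball is a
  global one: by \<open>outside\<close>, a self-avoiding path that leaves the ball costs more than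
  \<Gamma>.\<close>

lemma geodesic_exists:
  assumes nonneg: "\<forall>e\<in>lattice_edges. 0 \<le> \<tau> e"
    and shell: "\<forall>e\<in>shell_edges m n. c \<le> \<tau> e"
    and "0 < c" "l1_norm x \<le> m"
    and \<Gamma>: "connecting_path x y \<Gamma>" "path_time \<tau> \<Gamma> < c * of_int (n - m)"
  shows "\<exists>\<Delta>. geodesic \<tau> x y \<Delta>"
proof -
  have "0 < c * of_int (n - m)"
    using path_time_nonneg[OF nonneg, of \<Gamma>] \<Gamma> by (simp add: connecting_path_def)
  then have "m \<le> n"
    using \<open>0 < c\<close> by (simp add: zero_less_mult_iff)
  define S where "S = {\<Delta>. connecting_path x y \<Delta> \<and> distinct \<Delta> \<and> set \<Delta> \<subseteq> {v. l1_norm v \<le> n}}"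
  have outside: "c * of_int (n - m) \<le> path_time \<tau> \<Delta>"
    if \<Delta>: "connecting_path x y \<Delta>" "distinct \<Delta>" "\<Delta> \<notin> S" for \<Delta>
  proof -
    have "\<not> (\<forall>v\<in>set \<Delta>. l1_norm v \<le> n)"
      using \<Delta> by (auto simp: S_def)
    then obtain v where "v \<in> set \<Delta>" "n < l1_norm v" by (auto simp: not_le)
    then show ?thesis
      using \<Delta>(1) assms(3,4) \<open>m \<le> n\<close>
      by (intro path_time_leaving_ball[OF nonneg shell]) (auto simp: connecting_path_def)
  qed
  have "S \<subseteq> {\<Delta>. set \<Delta> \<subseteq> {v. l1_norm v \<le> n} \<and> distinct \<Delta>}" by (auto simp: S_def)
  then have "finite S"
    using finite_subset_distinct[OF finite_l1_ball] by (rule finite_subset)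
  obtain \<Gamma>' where \<Gamma>': "connecting_path x y \<Gamma>'" "distinct \<Gamma>'" "path_time \<tau> \<Gamma>' \<le> path_time \<tau> \<Gamma>"
    using self_avoiding_subpath[OF nonneg \<Gamma>(1)] by blast
  \<comment> \<open>This makes \<open>S\<close> nonempty and keeps its minimum below the cost of
    leaving the ball.\<close>
  then have "\<Gamma>' \<in> S" using outside[of \<Gamma>'] \<Gamma>(2) by force
  then obtain \<Delta> where \<Delta>: "\<Delta> \<in> S" "\<And>\<Delta>'. \<Delta>' \<in> S \<Longrightarrow> path_time \<tau> \<Delta> \<le> path_time \<tau> \<Delta>'"
    using \<open>finite S\<close> arg_min_if_finite(1)[of S "path_time \<tau>"] arg_min_least[of S _ "path_time \<tau>"]
    by (metis empty_iff)
  have "geodesic \<tau> x y \<Delta>"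
  proof (rule geodesicI)
    fix \<Delta>' assume "connecting_path x y \<Delta>'"
    then obtain \<Delta>'' where *: "connecting_path x y \<Delta>''" "distinct \<Delta>''"
      "path_time \<tau> \<Delta>'' \<le> path_time \<tau> \<Delta>'"
      using self_avoiding_subpath[OF nonneg] by blast
    show "path_time \<tau> \<Delta> \<le> path_time \<tau> \<Delta>'"
    proof (cases "\<Delta>'' \<in> S")
      case True
      then show ?thesis using \<Delta>(2) *(3) by force
    next
      case False
      then show ?thesis
        using outside[OF *(1,2)] \<Delta>(2)[OF \<open>\<Gamma>' \<in> S\<close>] \<Gamma>'(3) \<Gamma>(2) *(3) by linarith
    qed
  qed (use \<Delta>(1) in \<open>simp add: S_def\<close>)
  then show ?thesis ..
qed

section \<open>Generic configurations\<close>

lemma topspace_configurations: "topspace (configurations A) = lattice_edges \<rightarrow>\<^sub>E A"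
  by (simp add: configurations_def)

lemma continuous_map_edge_time:
  "e \<in> lattice_edges \<Longrightarrow> continuous_map (configurations A) euclideanreal (\<lambda>\<omega>. \<omega> e)"
  unfolding configurations_def
  by (rule continuous_map_into_fulltopology) (rule continuous_map_product_projection)

lemma continuous_map_path_time:
  "successively adjacent \<Gamma> \<Longrightarrow> continuous_map (configurations A) euclideanreal (\<lambda>\<omega>. path_time \<omega> \<Gamma>)"
  by (induction \<Gamma> rule: path_edges.induct)
    (auto intro!: continuous_map_add continuous_map_edge_time adjacent_in_lattice_edges)

text \<open>The hypotheses of \<open>geodesic_exists\<close>, with a strict inequality on the shell
  so that the set is open.\<close>

definition walled_off :: "real set \<Rightarrow> real \<Rightarrow> int ^ 'd \<Rightarrow> int ^ 'd \<Rightarrow> ((int ^ 'd) set \<Rightarrow> real) set" where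
  "walled_off A c x y = {\<omega> \<in> topspace (configurations A). \<exists>\<Gamma> m n.
     connecting_path x y \<Gamma> \<and> l1_norm x \<le> m \<and> path_time \<omega> \<Gamma> < c * of_int (n - m) \<and>
     (\<forall>e\<in>shell_edges m n. c < \<omega> e)}"

text \<open>For fixed \<Gamma>, \<open>m\<close> and \<open>n\<close> the shell is finite, so only
  finitely many strict inequalities between continuous functions and constants are imposed.\<close>

lemma openin_walled_off: "openin (configurations A) (walled_off A c x y)"
proof (subst openin_subopen, intro ballI)
  fix \<omega> assume "\<omega> \<in> walled_off A c x y"
  then obtain \<Gamma> m n where \<omega>: "\<omega> \<in> topspace (configurations A)" "connecting_path x y \<Gamma>"
    "l1_norm x \<le> m" "path_time \<omega> \<Gamma> < c * of_int (n - m)" "\<forall>e\<in>shell_edges m n. c < \<omega> e"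
    by (auto simp: walled_off_def)
  define P where "P = {\<omega> \<in> topspace (configurations A). path_time \<omega> \<Gamma> \<in> {..<c * of_int (n - m)}}"
  define Q where "Q e = {\<omega> \<in> topspace (configurations A). \<omega> e \<in> {c<..}}" for e :: "(int ^ 'a) set"
  have "openin (configurations A) P"
    unfolding P_def using \<omega>(2)
    by (intro openin_continuous_map_preimage[OF continuous_map_path_time])
      (auto simp: connecting_path_def)
  moreover have "openin (configurations A) (Q e)" if "e \<in> shell_edges m n" for e
    unfolding Q_def using that shell_edges_subset
    by (intro openin_continuous_map_preimage[OF continuous_map_edge_time]) auto
  ultimately have "openin (configurations A) (\<Inter>(insert P (Q ` shell_edges m n)))"
    using finite_shell_edges by (intro openin_Inter) auto
  moreover have "\<omega> \<in> \<Inter>(insert P (Q ` shell_edges m n))"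
    using \<omega> by (auto simp: P_def Q_def)
  moreover have "\<Inter>(insert P (Q ` shell_edges m n)) \<subseteq> walled_off A c x y"
    using \<omega>(2,3) by (auto simp: P_def Q_def walled_off_def)
  ultimately show "\<exists>T. openin (configurations A) T \<and> \<omega> \<in> T \<and> T \<subseteq> walled_off A c x y"
    by blast
qed

lemma dense_walled_off:
  fixes x y :: "int ^ 'd"
  assumes "b \<in> A" "0 < c" "c < b"
  shows "configurations A closure_of walled_off A c x y = topspace (configurations A)"
  unfolding dense_intersects_open
proof (intro allI impI, elim conjE)
  fix W :: "((int ^ 'd) set \<Rightarrow> real) set"
  assume W: "openin (configurations A) W" "W \<noteq> {}"
  then obtain \<omega>0 where \<omega>0: "\<omega>0 \<in> W" by blast
  then have \<omega>0_top: "\<omega>0 \<in> lattice_edges \<rightarrow>\<^sub>E A"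
    using W(1) openin_subset topspace_configurations by blast
  obtain F where F: "finite F" "F \<subseteq> lattice_edges"
    "\<And>\<omega>. \<omega> \<in> topspace (configurations A) \<Longrightarrow> (\<And>e. e \<in> F \<Longrightarrow> \<omega> e = \<omega>0 e) \<Longrightarrow> \<omega> \<in> W"
    using openin_product_topology_finite_support[OF W(1)[unfolded configurations_def] \<omega>0]
    unfolding configurations_def by blast
  \<comment> \<open>Off the lattice edges the value of \<open>\<omega>0\<close> is kept, so that
    \<omega> stays extensional.\<close>
  define \<omega> where "\<omega> e = (if e \<in> lattice_edges - F then b else \<omega>0 e)" for e
  have \<omega>_top: "\<omega> \<in> topspace (configurations A)"
    using \<omega>0_top assms(1) by (auto simp: \<omega>_def topspace_configurations PiE_iff extensional_def)
  have "\<omega> \<in> W" by (rule F(3)[OF \<omega>_top]) (simp add: \<omega>_def)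
  obtain \<Gamma> where \<Gamma>: "connecting_path x y \<Gamma>" using connecting_path_exists by blast
  have "finite (\<Union>F)"
    using F(1,2) by (auto simp: lattice_edges_def)
  then have "finite (insert x (\<Union>F))" by simp
  then have "bdd_above (l1_norm ` insert x (\<Union>F))" by (intro bdd_above_finite finite_imageI)
  then obtain m' where m': "\<And>v. v \<in> insert x (\<Union>F) \<Longrightarrow> l1_norm v \<le> m'"
    unfolding bdd_above_def by blast
  \<comment> \<open>Every endpoint of an edge in \<open>F\<close> has norm below \<open>m\<close>,
    so the shell avoids \<open>F\<close>.\<close>
  define m where "m = m' + 1"
  \<comment> \<open>There is no circularity: \<omega> equals \<open>b\<close> on every lattice edge
    outside \<open>F\<close>, so the time of \<Gamma> is already fixed when the thickness
    \<open>k\<close> of the shell is chosen.\<close>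
  obtain k :: nat where k: "path_time \<omega> \<Gamma> < of_nat k * c"
    using reals_Archimedean3[OF assms(2)] by blast
  have "c < \<omega> e" if "e \<in> shell_edges m (m + int k)" for e
  proof -
    from that obtain v where "v \<in> e" "m \<le> l1_norm v"
      by (auto simp: shell_edges_def)
    then have "e \<notin> F" using m'[of v] by (auto simp: m_def)
    then show ?thesis using that shell_edges_subset assms(3) by (auto simp: \<omega>_def)
  qed
  moreover have "l1_norm x \<le> m" using m'[of x] by (simp add: m_def)
  moreover have "path_time \<omega> \<Gamma> < c * of_int (m + int k - m)" using k by (simp add: mult.commute)
  ultimately have "\<omega> \<in> walled_off A c x y"
    unfolding walled_off_def using \<omega>_top \<Gamma> by blast
  with \<open>\<omega> \<in> W\<close> show "walled_off A c x y \<inter> W \<noteq> {}" by blast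
qed

section \<open>Separating passage times by changing one edge\<close>

lemma perturb_edge_time:
  assumes W: "openin (configurations A) W" "\<tau> \<in> W"
    and e: "e \<in> lattice_edges" and "\<not> \<tau> e isolated_in A"
  obtains t where "t \<in> A" "t \<noteq> \<tau> e" "\<tau>(e := t) \<in> W"
proof -
  have \<tau>: "\<tau> \<in> lattice_edges \<rightarrow>\<^sub>E A"
    using W openin_subset topspace_configurations by blast
  \<comment> \<open>By continuity of this one-edge variation, \<open>W\<close> pulls back to a
    relatively open subset of \<open>A\<close> around \<open>\<tau> e\<close>. Since that point is
    not isolated, the subset has a second point.\<close>
  have "continuous_map (top_of_set A) (configurations A) (\<lambda>t. \<tau>(e := t))"
    unfolding configurations_def continuous_map_componentwise
  proof (intro conjI ballI)
    fix e' :: "(int ^ 'a) set" assume "e' \<in> lattice_edges"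
    then show "continuous_map (top_of_set A) (top_of_set A) (\<lambda>t. (\<tau>(e := t)) e')"
      using \<tau> by (cases "e' = e") (auto simp: id_def[symmetric])
  qed (use \<tau> e in \<open>auto simp: extensional_def PiE_iff\<close>)
  from openin_continuous_map_preimage[OF this W(1)]
  obtain T where T: "open T" "{t \<in> A. \<tau>(e := t) \<in> W} = T \<inter> A"
    by (auto simp: openin_open)
  have "\<tau> e \<in> A" using \<tau> e by auto
  then have "\<tau> e \<in> {t \<in> A. \<tau>(e := t) \<in> W}" using W(2) by simp
  then have "\<tau> e \<in> T \<inter> A" unfolding T(2) .
  moreover have "T \<inter> A \<noteq> {\<tau> e}"
    using assms(4) isolated_inI[OF \<open>\<tau> e \<in> A\<close> T(1)] by blast
  ultimately obtain t where "t \<in> T \<inter> A" "t \<noteq> \<tau> e" by blast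
  moreover from this(1) have "t \<in> {t \<in> A. \<tau>(e := t) \<in> W}" unfolding T(2) .
  ultimately show thesis using that by blast
qed

definition time_separated :: "real set \<Rightarrow> (int ^ 'd) list \<Rightarrow> (int ^ 'd) list \<Rightarrow> ((int ^ 'd) set \<Rightarrow> real) set"
  where "time_separated A p q =
    {\<omega> \<in> topspace (configurations A). path_time \<omega> p - path_time \<omega> q \<in> - {0}}"

lemma openin_time_separated:
  assumes "successively adjacent p" "successively adjacent q"
  shows "openin (configurations A) (time_separated A p q)"
  unfolding time_separated_def
proof (rule openin_continuous_map_preimage)
  show "continuous_map (configurations A) euclideanreal (\<lambda>\<omega>. path_time \<omega> p - path_time \<omega> q)"
    using assms by (intro continuous_map_diff continuous_map_path_time)
qed (simp add: open_Compl)

lemma dense_time_separated: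
  fixes p q :: "(int ^ 'd) list"
  assumes "\<And>a. \<not> a isolated_in A"
    and "successively adjacent p" "successively adjacent q"
    and "mset (path_edges p) \<noteq> mset (path_edges q)"
  shows "configurations A closure_of time_separated A p q = topspace (configurations A)"
  unfolding dense_intersects_open
proof (intro allI impI, elim conjE)
  fix W :: "((int ^ 'd) set \<Rightarrow> real) set"
  assume W: "openin (configurations A) W" "W \<noteq> {}"
  then obtain \<tau> where \<tau>: "\<tau> \<in> W" by blast
  have W_top: "W \<subseteq> topspace (configurations A)" using W(1) openin_subset by blast
  obtain e where e: "count (mset (path_edges p)) e \<noteq> count (mset (path_edges q)) e"
    using assms(4) multiset_eq_iff by blast
  then have "e \<in> set (path_edges p) \<union> set (path_edges q)"
    by (metis UnCI count_inI set_mset_mset)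
  then have "e \<in> lattice_edges"
    using path_edges_subset_lattice_edges assms(2,3) by blast
  from perturb_edge_time[OF W(1) \<tau> this assms(1)]
  obtain t where t: "t \<noteq> \<tau> e" "fun_upd \<tau> e t \<in> W" by blast
  let ?\<delta> = "\<lambda>\<sigma>. path_time \<sigma> p - path_time \<sigma> q"
  \<comment> \<open>The slope is the difference of the multiplicities of \<open>e\<close>, nonzero
    by choice of \<open>e\<close>. So the time difference cannot vanish both before and after the
    change.\<close>
  have "?\<delta> (\<tau>(e := t)) - ?\<delta> \<tau> =
      (real (count (mset (path_edges p)) e) - real (count (mset (path_edges q)) e)) * (t - \<tau> e)"
    by (simp add: path_time_fun_upd algebra_simps)
  moreover have "\<dots> \<noteq> 0" using e t(1) by simp
  ultimately have "?\<delta> (\<tau>(e := t)) \<noteq> 0 \<or> ?\<delta> \<tau> \<noteq> 0" by force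
  then show "time_separated A p q \<inter> W \<noteq> {}"
    using \<tau> t(2) W_top by (auto simp: time_separated_def)
qed

section \<open>Uniqueness of geodesics and the conclusion\<close>

lemma geodesic_unique:
  assumes nonneg: "\<forall>e\<in>lattice_edges. 0 \<le> \<tau> e"
    and separated: "\<And>p q. successively adjacent p \<Longrightarrow> successively adjacent q \<Longrightarrow>
        path_time \<tau> p = path_time \<tau> q \<Longrightarrow> mset (path_edges p) = mset (path_edges q)"
    and geodesics: "geodesic \<tau> x y p" "geodesic \<tau> x y q"
  shows "p = q"
proof -
  have distinct: "distinct p" if p: "geodesic \<tau> x y p" for p
  proof (rule ccontr)
    assume "\<not> distinct p"
    moreover have path: "connecting_path x y p" using p by (simp add: geodesic_def)
    ultimately obtain q where q: "connecting_path x y q"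
      "mset (path_edges q) \<subset># mset (path_edges p)"
      using connecting_path_remove_loop by blast
    \<comment> \<open>Only a weak inequality is available, since edges may have time 0 and a loop
      may be free. Separation of passage times is what rules out such loops.\<close>
    have "path_time \<tau> q \<le> path_time \<tau> p"
      using q(2) path by (intro path_time_mset_mono[OF nonneg])
        (auto simp: connecting_path_def subset_mset.less_imp_le)
    then have "path_time \<tau> q = path_time \<tau> p"
      using geodesicD[OF nonneg p q(1)] by simp
    then have "mset (path_edges q) = mset (path_edges p)"
      using separated q(1) path by (simp add: connecting_path_def)
    with q(2) show False by simp
  qed
  have paths: "connecting_path x y p" "connecting_path x y q" and "path_time \<tau> p = path_time \<tau> q"
    using geodesics by (auto simp: geodesic_def)
  then have "mset (path_edges p) = mset (path_edges q)"
    using separated by (simp add: connecting_path_def)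
  then show ?thesis
    using distinct geodesics paths
    by (intro self_avoiding_path_eqI) (auto simp: connecting_path_def dest: mset_eq_setD)
qed

theorem theorem1p1:
  fixes A :: "real set"
  assumes "A \<subseteq> {0..}"
    and "\<exists>a\<in>A. \<exists>b\<in>A. a \<noteq> b"
  shows "(\<exists>R :: ((int ^ 'd) set \<Rightarrow> real) set.
            residual_in (configurations A) R \<and>
            (\<forall>\<omega>\<in>R. \<forall>x y. \<exists>\<Gamma>. geodesic \<omega> x y \<Gamma>)) \<and>
         ((\<forall>a. \<not> a isolated_in A) \<longrightarrow>
          (\<exists>R' :: ((int ^ 'd) set \<Rightarrow> real) set.
            residual_in (configurations A) R' \<and>
            (\<forall>\<omega>\<in>R'. \<forall>x y. \<exists>!\<Gamma>. geodesic \<omega> x y \<Gamma>)))"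
proof -
  \<comment> \<open>Of two distinct nonnegative numbers at least one is positive.\<close>
  obtain b where b: "b \<in> A" "0 < b"
    using assms by (metis atLeast_iff order_le_less subsetD)
  have nonneg: "0 \<le> \<omega> e"
    if "\<omega> \<in> topspace (configurations A)" "e \<in> lattice_edges" for \<omega> and e :: "(int ^ 'd) set"
    using that assms(1) by (auto simp: topspace_configurations)
  define X :: "((int ^ 'd) set \<Rightarrow> real) topology" where "X = configurations A"
  define \<U> :: "((int ^ 'd) set \<Rightarrow> real) set set"
    \<comment> \<open>The level \<open>b / 2\<close> lies strictly between 0 and \<open>b\<close>,
      as density requires.\<close>
    where "\<U> = (\<lambda>(x, y). walled_off A (b / 2) x y) ` UNIV"
  define \<V> :: "((int ^ 'd) set \<Rightarrow> real) set set"
    where "\<V> = (\<lambda>(p, q). time_separated A p q) ` {(p, q). successively adjacent p \<and>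
      successively adjacent q \<and> mset (path_edges p) \<noteq> mset (path_edges q)}"
  have "countable \<U>" "countable \<V>" by (auto simp: \<U>_def \<V>_def)
  have \<U>: "openin X U \<and> X closure_of U = topspace X" if "U \<in> \<U>" for U
    using that b by (auto simp: \<U>_def X_def openin_walled_off dense_walled_off[OF b(1)])
  have existence: "\<exists>\<Gamma>. geodesic \<omega> x y \<Gamma>" if \<omega>: "\<omega> \<in> topspace X \<inter> \<Inter>\<U>" for \<omega> x y
  proof -
    have "\<omega> \<in> walled_off A (b / 2) x y" using \<omega> by (auto simp: \<U>_def)
    then obtain \<Gamma> m n where "connecting_path x y \<Gamma>" "l1_norm x \<le> m"
      "path_time \<omega> \<Gamma> < b / 2 * of_int (n - m)" "\<forall>e\<in>shell_edges m n. b / 2 < \<omega> e"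
      unfolding walled_off_def by blast
    then show ?thesis
      using \<omega> b(2) nonneg by (intro geodesic_exists[of \<omega> m n "b / 2"]) (auto simp: X_def less_imp_le)
  qed
  have "residual_in X (topspace X \<inter> \<Inter>\<U>)"
    using \<open>countable \<U>\<close> \<U> by (intro residual_in_countable_Inter) auto
  then have part1: "\<exists>R. residual_in X R \<and> (\<forall>\<omega>\<in>R. \<forall>x y. \<exists>\<Gamma>. geodesic \<omega> x y \<Gamma>)"
    using existence by blast
  have part2: "\<exists>R'. residual_in X R' \<and> (\<forall>\<omega>\<in>R'. \<forall>x y. \<exists>!\<Gamma>. geodesic \<omega> x y \<Gamma>)"
    if "\<forall>a. \<not> a isolated_in A"
  proof (intro exI conjI ballI allI)
    have "openin X V \<and> X closure_of V = topspace X" if "V \<in> \<V>" for V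
      using that \<open>\<forall>a. \<not> a isolated_in A\<close>
      by (auto simp: \<V>_def X_def openin_time_separated dense_time_separated)
    \<comment> \<open>Membership in all of \<open>\<U>\<close> gives existence, membership in all of
      \<open>\<V>\<close> gives uniqueness.\<close>
    then show "residual_in X (topspace X \<inter> \<Inter>(\<U> \<union> \<V>))"
      using \<open>countable \<U>\<close> \<open>countable \<V>\<close> \<U> by (intro residual_in_countable_Inter) auto
    fix \<omega> x y assume \<omega>: "\<omega> \<in> topspace X \<inter> \<Inter>(\<U> \<union> \<V>)"
    have separated: "mset (path_edges p) = mset (path_edges q)"
      if "successively adjacent p" "successively adjacent q" "path_time \<omega> p = path_time \<omega> q" for p q
    proof (rule ccontr)
      assume "mset (path_edges p) \<noteq> mset (path_edges q)"
      then have "time_separated A p q \<in> \<V>" using that by (auto simp: \<V>_def)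
      then have "\<omega> \<in> time_separated A p q" using \<omega> by blast
      then show False using that(3) by (simp add: time_separated_def)
    qed
    have "\<forall>e\<in>lattice_edges. 0 \<le> \<omega> e"
      using \<omega> nonneg by (auto simp: X_def)
    then show "\<exists>!\<Gamma>. geodesic \<omega> x y \<Gamma>"
      using existence[of \<omega> x y] \<omega> geodesic_unique[OF _ separated] by blast
  qed
  show ?thesis using part1 part2 unfolding X_def by blast
qed

end
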